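(* Let $n\ge 2$. Every $\mathsf{GA}_n$-algebra free over an infinite set is not a bi-Heyting algebra.
   Context: A Gödel algebra is a Heyting algebra with $(x\to y)\vee(y\to x)=1$; with $\mathsf{bd}_0=0$, $\mathsf{bd}_n=x_n\vee(x_n\to\mathsf{bd}_{n-1})$, $\mathsf{GA}_n$ is the variety of Gödel algebras satisfying $\mathsf{bd}_n=1$. The $\mathsf{GA}_n$-algebra free over a set $S$ is the free algebra on $S$ in the variety $\mathsf{GA}_n$. A bi-Heyting algebra is a Heyting algebra whose order dual is also a Heyting algebra. *)

theory Defs
  imports "HOL-Algebra.Lattice" "HOL-Library.FuncSet"
begin

text \<open>
  A Heyting algebra is presented by its order, as a bounded lattice of HOL-Algebra in which all
  relative pseudocomplements exist. The operations of the signature are determined by the order,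
  and the order dual is \<^term>\<open>inv_gorder L\<close>.
\<close>

definition himp :: "[_, 'a, 'a] \<Rightarrow> 'a" (infixr \<open>\<rightharpoonup>\<index>\<close> 60)
  where "x \<rightharpoonup>\<^bsub>L\<^esub> y = (SOME z. greatest L z {w \<in> carrier L. w \<sqinter>\<^bsub>L\<^esub> x \<sqsubseteq>\<^bsub>L\<^esub> y})"

locale heyting_algebra = bounded_lattice +
  assumes himp_exists:
    "\<lbrakk>x \<in> carrier L; y \<in> carrier L\<rbrakk>
      \<Longrightarrow> \<exists>z. greatest L z {w \<in> carrier L. w \<sqinter> x \<sqsubseteq> y}"

definition bi_heyting_algebra :: "('a, 'm) gorder_scheme \<Rightarrow> bool"
  where "bi_heyting_algebra L \<longleftrightarrow> heyting_algebra L \<and> heyting_algebra (inv_gorder L)"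

locale goedel_algebra = heyting_algebra +
  assumes prelinear:
    "\<lbrakk>x \<in> carrier L; y \<in> carrier L\<rbrakk> \<Longrightarrow> (x \<rightharpoonup> y) \<squnion> (y \<rightharpoonup> x) = \<top>"

primrec bd :: "('a, 'm) gorder_scheme \<Rightarrow> (nat \<Rightarrow> 'a) \<Rightarrow> nat \<Rightarrow> 'a"
  where
    "bd L x 0 = \<bottom>\<^bsub>L\<^esub>"
  | "bd L x (Suc n) = x (Suc n) \<squnion>\<^bsub>L\<^esub> (x (Suc n) \<rightharpoonup>\<^bsub>L\<^esub> bd L x n)"

locale GA_algebra = goedel_algebra L for L (structure) and n :: nat +
  assumes bd_eq_top: "x \<in> {1..n} \<rightarrow> carrier L \<Longrightarrow> bd L x n = \<top>"

definition heyting_hom :: "('a, 'm) gorder_scheme \<Rightarrow> ('b, 'k) gorder_scheme \<Rightarrow> ('a \<Rightarrow> 'b) set"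
  where "heyting_hom A B =
    {h \<in> carrier A \<rightarrow> carrier B.
      h \<bottom>\<^bsub>A\<^esub> = \<bottom>\<^bsub>B\<^esub> \<and> h \<top>\<^bsub>A\<^esub> = \<top>\<^bsub>B\<^esub> \<and>
      (\<forall>x\<in>carrier A. \<forall>y\<in>carrier A.
        h (x \<squnion>\<^bsub>A\<^esub> y) = h x \<squnion>\<^bsub>B\<^esub> h y \<and>
        h (x \<sqinter>\<^bsub>A\<^esub> y) = h x \<sqinter>\<^bsub>B\<^esub> h y \<and>
        h (x \<rightharpoonup>\<^bsub>A\<^esub> y) = h x \<rightharpoonup>\<^bsub>B\<^esub> h y)}"

text \<open>
  The universal property of the free algebra. A formula cannot quantify over types, so the test
  algebras \<open>B\<close> live in the type of \<open>A\<close>; uniqueness is uniqueness on \<^term>\<open>carrier A\<close>,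
  hence the restriction to extensional functions. For infinite \<open>S\<close> (the only case used here)
  nothing is lost: lemma \<open>free_GA_algebra_universal\<close> below derives the universal property for
  test algebras in an arbitrary type.
\<close>

definition free_GA_algebra :: "nat \<Rightarrow> 'a gorder \<Rightarrow> 'a set \<Rightarrow> bool"
  where "free_GA_algebra n A S \<longleftrightarrow>
    GA_algebra A n \<and> S \<subseteq> carrier A \<and>
    (\<forall>(B :: 'a gorder) f. GA_algebra B n \<longrightarrow> f \<in> S \<rightarrow> carrier B \<longrightarrow>
      (\<exists>!h. h \<in> heyting_hom A B \<inter> extensional (carrier A) \<and> (\<forall>s\<in>S. h s = f s)))"


lemma (in heyting_algebra) himp_greatest:
  assumes "x \<in> carrier L" "y \<in> carrier L"
  shows "greatest L (x \<rightharpoonup> y) {w \<in> carrier L. w \<sqinter> x \<sqsubseteq> y}"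
  using someI_ex[OF himp_exists[OF assms]] by (simp add: himp_def)

lemma (in heyting_algebra) himp_closed [simp]:
  "\<lbrakk>x \<in> carrier L; y \<in> carrier L\<rbrakk> \<Longrightarrow> x \<rightharpoonup> y \<in> carrier L"
  using himp_greatest by (auto simp: greatest_def)

lemma (in heyting_algebra) bd_closed:
  "x \<in> {1..k} \<rightarrow> carrier L \<Longrightarrow> bd L x k \<in> carrier L"
  by (induction k) (auto simp: Pi_iff)

primrec heyting_cl :: "('a, 'm) gorder_scheme \<Rightarrow> 'a set \<Rightarrow> nat \<Rightarrow> 'a set"
  where
    "heyting_cl L X 0 = X \<union> {\<bottom>\<^bsub>L\<^esub>, \<top>\<^bsub>L\<^esub>}"
  | "heyting_cl L X (Suc k) = heyting_cl L X k \<union>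
      (\<lambda>(x, y). x \<squnion>\<^bsub>L\<^esub> y) ` (heyting_cl L X k \<times> heyting_cl L X k) \<union>
      (\<lambda>(x, y). x \<sqinter>\<^bsub>L\<^esub> y) ` (heyting_cl L X k \<times> heyting_cl L X k) \<union>
      (\<lambda>(x, y). x \<rightharpoonup>\<^bsub>L\<^esub> y) ` (heyting_cl L X k \<times> heyting_cl L X k)"

lemma heyting_cl_inj:
  includes cardinal_syntax
  assumes inf: "infinite (UNIV :: 'a set)" and X: "|X| \<le>o |UNIV :: 'a set|"
  shows "\<exists>g :: 'b \<Rightarrow> 'a. inj_on g (\<Union>k. heyting_cl L X k)"
proof -
  have un: "|P \<union> Q| \<le>o |UNIV :: 'a set|"
    if "|P| \<le>o |UNIV :: 'a set|" "|Q| \<le>o |UNIV :: 'a set|" for P Q :: "'b set"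
    using card_of_Un_ordLeq_infinite_Field[OF _ that card_of_Card_order] inf by (simp add: Field_card_of)
  have im: "|F ` (P \<times> P)| \<le>o |UNIV :: 'a set|" if "|P| \<le>o |UNIV :: 'a set|"
    for P :: "'b set" and F :: "'b \<times> 'b \<Rightarrow> 'b"
    by (rule ordLeq_transitive[OF card_of_image
          card_of_Times_ordLeq_infinite_Field[OF _ that that card_of_Card_order]])
      (simp add: Field_card_of inf)
  have "|heyting_cl L X k| \<le>o |UNIV :: 'a set|" for k
  proof (induction k)
    case 0
    have "|X \<union> ({\<bottom>\<^bsub>L\<^esub>} \<union> {\<top>\<^bsub>L\<^esub>})| \<le>o |UNIV :: 'a set|"
      by (intro un X card_of_singl_ordLeq) simp_all
    then show ?case by (simp add: insert_commute)
  next
    case (Suc k)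
    show ?case unfolding heyting_cl.simps by (intro un im Suc)
  qed
  then have "|\<Union>k. heyting_cl L X k| \<le>o |UNIV :: 'a set|"
    using inf by (intro card_of_UNION_ordLeq_infinite)
      (simp_all add: infinite_iff_card_of_nat[symmetric])
  then show ?thesis using card_of_ordLeq[of "\<Union>k. heyting_cl L X k" "UNIV :: 'a set"] by auto
qed

lemma GA_algebra_transfer:
  includes cardinal_syntax
  fixes B :: "('b, 'm) gorder_scheme" and X :: "'b set"
  assumes GA: "GA_algebra B n" and XB: "X \<subseteq> carrier B"
    and inf: "infinite (UNIV :: 'a set)" and X: "|X| \<le>o |UNIV :: 'a set|"
  obtains B' :: "'a gorder" and j
  where "GA_algebra B' n" "inj_on j (carrier B')" "j \<in> heyting_hom B' B" "X \<subseteq> j ` carrier B'"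
proof -
  interpret B: GA_algebra B n by (rule GA)
  define C where "C = (\<Union>k. heyting_cl B X k)"
  have "heyting_cl B X k \<subseteq> carrier B" for k
  proof (induction k)
    case (Suc k)
    then have "a \<in> carrier B" if "a \<in> heyting_cl B X k" for a using that by blast
    then show ?case by auto
  qed (use XB in auto)
  then have CB: "C \<subseteq> carrier B" by (auto simp: C_def)
  have XC: "X \<subseteq> C" "\<bottom>\<^bsub>B\<^esub> \<in> C" "\<top>\<^bsub>B\<^esub> \<in> C"
    by (auto simp: C_def intro!: exI[of _ 0])
  have mono: "heyting_cl B X k \<subseteq> heyting_cl B X l" if "k \<le> l" for k l
    by (rule lift_Suc_mono_le[OF _ that]) auto
  have op: "x \<squnion>\<^bsub>B\<^esub> y \<in> C \<and> x \<sqinter>\<^bsub>B\<^esub> y \<in> C \<and> x \<rightharpoonup>\<^bsub>B\<^esub> y \<in> C" if xy: "x \<in> C" "y \<in> C" for x y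
  proof -
    obtain k l where "x \<in> heyting_cl B X k" "y \<in> heyting_cl B X l"
      using xy by (auto simp: C_def)
    then have "x \<in> heyting_cl B X (max k l)" "y \<in> heyting_cl B X (max k l)"
      using mono[of k "max k l"] mono[of l "max k l"] by auto
    then have "x \<squnion>\<^bsub>B\<^esub> y \<in> heyting_cl B X (Suc (max k l))"
      "x \<sqinter>\<^bsub>B\<^esub> y \<in> heyting_cl B X (Suc (max k l))"
      "x \<rightharpoonup>\<^bsub>B\<^esub> y \<in> heyting_cl B X (Suc (max k l))"
      by force+
    then show ?thesis unfolding C_def by blast
  qed
  obtain g :: "'b \<Rightarrow> 'a" where g: "inj_on g C"
    using heyting_cl_inj[OF inf X, of B] by (auto simp: C_def)
  define j where "j = inv_into C g"
  define B' :: "'a gorder" where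
    "B' = \<lparr>carrier = g ` C, eq = (=), le = (\<lambda>u v. j u \<sqsubseteq>\<^bsub>B\<^esub> j v)\<rparr>"
  have car: "carrier B' = g ` C" and le: "u \<sqsubseteq>\<^bsub>B'\<^esub> v \<longleftrightarrow> j u \<sqsubseteq>\<^bsub>B\<^esub> j v" for u v
    by (simp_all add: B'_def)
  have jg: "j (g x) = x" if "x \<in> C" for x
    using g that by (simp add: j_def)
  have gj: "g (j u) = u" and jC: "j u \<in> C" and jB: "j u \<in> carrier B" if "u \<in> carrier B'" for u
    using that CB by (auto simp: car jg)
  have inj: "inj_on j (carrier B')"
    by (metis gj inj_onI)
  have po: "partial_order B'"
  proof (unfold_locales)
    show "x .=\<^bsub>B'\<^esub> y" if "x \<sqsubseteq>\<^bsub>B'\<^esub> y" "y \<sqsubseteq>\<^bsub>B'\<^esub> x" "x \<in> carrier B'" "y \<in> carrier B'" for x y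
      using inj_onD[OF inj B.le_antisym that(3,4)] that(1,2) jB[OF that(3)] jB[OF that(4)]
      by (simp add: le) (simp add: B'_def)
    show "x \<sqsubseteq>\<^bsub>B'\<^esub> z" if "x \<sqsubseteq>\<^bsub>B'\<^esub> y" "y \<sqsubseteq>\<^bsub>B'\<^esub> z" "x \<in> carrier B'" "y \<in> carrier B'" "z \<in> carrier B'" for x y z
      using B.le_trans[of "j x" "j y" "j z"] that jB[OF that(3)] jB[OF that(4)] jB[OF that(5)]
      by (simp add: le)
    show "x \<sqsubseteq>\<^bsub>B'\<^esub> x" if "x \<in> carrier B'" for x
      using that jB unfolding le by simp
  qed (auto simp: B'_def)
  interpret B': partial_order B' by (rule po)
  have gC: "x \<in> C \<Longrightarrow> g x \<in> carrier B'" for x by (simp add: car)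
  have bot: "least B' (g \<bottom>\<^bsub>B\<^esub>) (carrier B')"
    using XC by (auto simp: least_def le jg gC jB)
  have top: "greatest B' (g \<top>\<^bsub>B\<^esub>) (carrier B')"
    using XC by (auto simp: greatest_def le jg gC jB)
  have join: "least B' (g (j u \<squnion>\<^bsub>B\<^esub> j v)) (Upper B' {u, v})"
    if uv: "u \<in> carrier B'" "v \<in> carrier B'" for u v
    using op[OF jC[OF uv(1)] jC[OF uv(2)]] uv
    by (auto simp: least_def Upper_def le jg gC jB B.join_left B.join_right intro!: B.join_le)
  have meet: "greatest B' (g (j u \<sqinter>\<^bsub>B\<^esub> j v)) (Lower B' {u, v})"
    if uv: "u \<in> carrier B'" "v \<in> carrier B'" for u v
    using op[OF jC[OF uv(1)] jC[OF uv(2)]] uv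
    by (auto simp: greatest_def Lower_def le jg gC jB B.meet_left B.meet_right intro!: B.meet_le)
  interpret B': bounded_lattice B'
    using join meet bot top by unfold_locales blast+
  have jbot: "j \<bottom>\<^bsub>B'\<^esub> = \<bottom>\<^bsub>B\<^esub>"
    using B'.least_unique[OF bot B'.bottom_least] XC by (metis jg)
  have jtop: "j \<top>\<^bsub>B'\<^esub> = \<top>\<^bsub>B\<^esub>"
    using B'.greatest_unique[OF top B'.top_greatest] XC by (metis jg)
  have jjoin: "j (u \<squnion>\<^bsub>B'\<^esub> v) = j u \<squnion>\<^bsub>B\<^esub> j v" if uv: "u \<in> carrier B'" "v \<in> carrier B'" for u v
    using B'.least_unique[OF join[OF uv] B'.sup_of_two_least[OF uv]] op jC uv
    by (metis jg join_def)
  have jmeet: "j (u \<sqinter>\<^bsub>B'\<^esub> v) = j u \<sqinter>\<^bsub>B\<^esub> j v" if uv: "u \<in> carrier B'" "v \<in> carrier B'" for u v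
    using B'.greatest_unique[OF meet[OF uv] B'.inf_of_two_greatest[OF uv]] op jC uv
    by (metis jg meet_def)
  have imp: "greatest B' (g (j u \<rightharpoonup>\<^bsub>B\<^esub> j v)) {w \<in> carrier B'. w \<sqinter>\<^bsub>B'\<^esub> u \<sqsubseteq>\<^bsub>B'\<^esub> v}"
    if uv: "u \<in> carrier B'" "v \<in> carrier B'" for u v
    using op[OF jC[OF uv(1)] jC[OF uv(2)]] uv B.himp_greatest[OF jB[OF uv(1)] jB[OF uv(2)]]
    by (auto simp: greatest_def le jg gC jB jmeet)
  interpret B': heyting_algebra B'
    using imp by unfold_locales blast
  have jimp: "j (u \<rightharpoonup>\<^bsub>B'\<^esub> v) = j u \<rightharpoonup>\<^bsub>B\<^esub> j v" if uv: "u \<in> carrier B'" "v \<in> carrier B'" for u v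
    using B'.greatest_unique[OF imp[OF uv] B'.himp_greatest[OF uv]] op jC uv
    by (metis jg)
  have jbd: "x \<in> {1..k} \<rightarrow> carrier B' \<Longrightarrow> j (bd B' x k) = bd B (j \<circ> x) k" for x k
  proof (induction k)
    case (Suc k)
    then have "x \<in> {1..k} \<rightarrow> carrier B'" "x (Suc k) \<in> carrier B'" by (auto simp: Pi_iff)
    with Suc.IH B'.bd_closed[of x k] show ?case by (simp add: jjoin jimp)
  qed (simp add: jbot)
  have eqI: "u = v" if "u \<in> carrier B'" "v \<in> carrier B'" "j u = j v" for u v
    using inj that by (auto dest: inj_onD)
  have "GA_algebra B' n"
  proof unfold_locales
    show "(x \<rightharpoonup>\<^bsub>B'\<^esub> y) \<squnion>\<^bsub>B'\<^esub> (y \<rightharpoonup>\<^bsub>B'\<^esub> x) = \<top>\<^bsub>B'\<^esub>"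
      if "x \<in> carrier B'" "y \<in> carrier B'" for x y
      using that by (intro eqI) (simp_all add: jjoin jimp jtop jB B.prelinear)
    show "bd B' x n = \<top>\<^bsub>B'\<^esub>" if "x \<in> {1..n} \<rightarrow> carrier B'" for x
    proof (rule eqI)
      have "j \<circ> x \<in> {1..n} \<rightarrow> carrier B" using that jB by (auto simp: Pi_iff)
      then show "j (bd B' x n) = j \<top>\<^bsub>B'\<^esub>" using that by (simp add: jbd jtop B.bd_eq_top)
    qed (use that B'.bd_closed in auto)
  qed
  moreover have "j \<in> heyting_hom B' B"
    by (auto simp: heyting_hom_def jbot jtop jjoin jmeet jimp jB)
  moreover have "X \<subseteq> j ` carrier B'"
    using XC(1) by (force simp: car jg image_image)
  ultimately show ?thesis using that inj by blast
qed

lemma heyting_hom_comp: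
  assumes "heyting_algebra A" "h \<in> heyting_hom A B" "k \<in> heyting_hom B C"
  shows "restrict (k \<circ> h) (carrier A) \<in> heyting_hom A C"
proof -
  interpret A: heyting_algebra A by fact
  show ?thesis using assms(2,3) by (auto simp: heyting_hom_def Pi_iff)
qed

lemma heyting_hom_factor:
  assumes "heyting_algebra A" "heyting_algebra B" "h \<in> heyting_hom A C" "k \<in> heyting_hom B C"
    and inj: "inj_on k (carrier B)" and sub: "h ` carrier A \<subseteq> k ` carrier B"
  obtains h' where "h' \<in> heyting_hom A B \<inter> extensional (carrier A)"
    "\<And>x. x \<in> carrier A \<Longrightarrow> k (h' x) = h x"
proof -
  interpret A: heyting_algebra A by fact
  interpret B: heyting_algebra B by fact
  define h' where "h' = restrict (inv_into (carrier B) k \<circ> h) (carrier A)"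
  have kh: "k (h' x) = h x" and cl: "h' x \<in> carrier B" if "x \<in> carrier A" for x
    using that sub by (auto simp: h'_def f_inv_into_f inv_into_into subset_iff)
  have eqI: "h' x = y" if "x \<in> carrier A" "y \<in> carrier B" "h x = k y" for x y
    by (rule inj_onD[OF inj]) (use that kh cl in auto)
  have "h' \<in> heyting_hom A B"
    using assms(3,4) by (auto simp: heyting_hom_def Pi_iff kh cl intro!: eqI)
  moreover have "h' \<in> extensional (carrier A)" by (simp add: h'_def)
  ultimately show ?thesis using that kh by blast
qed

lemma free_GA_algebra_universal:
  includes cardinal_syntax
  fixes A :: "'a gorder" and B :: "'b gorder"
  assumes free: "free_GA_algebra n A S" and inf: "infinite S"
    and B: "GA_algebra B n" and f: "f \<in> S \<rightarrow> carrier B"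
  shows "\<exists>!h. h \<in> heyting_hom A B \<inter> extensional (carrier A) \<and> (\<forall>s\<in>S. h s = f s)"
proof -
  have GA: "GA_algebra A n" and SA: "S \<subseteq> carrier A"
    and univ: "\<And>(B :: 'a gorder) f. \<lbrakk>GA_algebra B n; f \<in> S \<rightarrow> carrier B\<rbrakk> \<Longrightarrow>
      \<exists>!h. h \<in> heyting_hom A B \<inter> extensional (carrier A) \<and> (\<forall>s\<in>S. h s = f s)"
    using free by (auto simp: free_GA_algebra_def)
  interpret A: GA_algebra A n by (rule GA)
  have iA: "infinite (UNIV :: 'a set)"
    using infinite_super[OF subset_UNIV inf] .
  have small: "|F ` P| \<le>o |UNIV :: 'a set|" for F :: "'a \<Rightarrow> 'b" and P
    by (rule ordLeq_transitive[OF card_of_image card_of_mono1]) simp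
  show ?thesis
  proof (rule ex_ex1I)
    have fS: "f ` S \<subseteq> carrier B" using f by auto
    obtain B' :: "'a gorder" and j where B': "GA_algebra B' n" "inj_on j (carrier B')"
      "j \<in> heyting_hom B' B" "f ` S \<subseteq> j ` carrier B'"
      using GA_algebra_transfer[OF B fS iA small] by blast
    define f' where "f' = inv_into (carrier B') j \<circ> f"
    have f': "f' \<in> S \<rightarrow> carrier B'" "\<And>s. s \<in> S \<Longrightarrow> j (f' s) = f s"
      using B'(4) by (auto simp: f'_def inv_into_into f_inv_into_f image_subset_iff)
    obtain h where h: "h \<in> heyting_hom A B'" "\<forall>s\<in>S. h s = f' s"
      using univ[OF B'(1) f'(1)] by blast
    have "restrict (j \<circ> h) (carrier A) \<in> heyting_hom A B"
      by (rule heyting_hom_comp[OF A.heyting_algebra_axioms h(1) B'(3)])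
    moreover have "\<forall>s\<in>S. restrict (j \<circ> h) (carrier A) s = f s"
      using h(2) f'(2) SA by auto
    ultimately show "\<exists>h. h \<in> heyting_hom A B \<inter> extensional (carrier A) \<and> (\<forall>s\<in>S. h s = f s)"
      by (intro exI[of _ "restrict (j \<circ> h) (carrier A)"]) auto
  next
    fix h1 h2
    assume h1: "h1 \<in> heyting_hom A B \<inter> extensional (carrier A) \<and> (\<forall>s\<in>S. h1 s = f s)"
      and h2: "h2 \<in> heyting_hom A B \<inter> extensional (carrier A) \<and> (\<forall>s\<in>S. h2 s = f s)"
    have sub: "h1 ` carrier A \<union> h2 ` carrier A \<subseteq> carrier B"
      using h1 h2 by (auto simp: heyting_hom_def Pi_iff)
    have "|h1 ` carrier A \<union> h2 ` carrier A| \<le>o |UNIV :: 'a set|"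
      using card_of_Un_ordLeq_infinite_Field[OF _ small small card_of_Card_order] iA by (simp add: Field_card_of)
    then obtain B' :: "'a gorder" and j where B': "GA_algebra B' n" "inj_on j (carrier B')"
      "j \<in> heyting_hom B' B" "h1 ` carrier A \<union> h2 ` carrier A \<subseteq> j ` carrier B'"
      using GA_algebra_transfer[OF B sub iA] by blast
    interpret B': GA_algebra B' n by (rule B')
    obtain k1 where k1: "k1 \<in> heyting_hom A B' \<inter> extensional (carrier A)"
      "\<And>x. x \<in> carrier A \<Longrightarrow> j (k1 x) = h1 x"
      using heyting_hom_factor[OF A.heyting_algebra_axioms B'.heyting_algebra_axioms _ B'(3,2)] h1 B'(4)
      by (metis IntD1 le_sup_iff)
    obtain k2 where k2: "k2 \<in> heyting_hom A B' \<inter> extensional (carrier A)"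
      "\<And>x. x \<in> carrier A \<Longrightarrow> j (k2 x) = h2 x"
      using heyting_hom_factor[OF A.heyting_algebra_axioms B'.heyting_algebra_axioms _ B'(3,2)] h2 B'(4)
      by (metis IntD1 le_sup_iff)
    have c: "k1 x \<in> carrier B'" "k2 x \<in> carrier B'" if "x \<in> carrier A" for x
      using k1(1) k2(1) that by (auto simp: heyting_hom_def)
    have "k2 s = k1 s" if "s \<in> S" for s
    proof (rule inj_onD[OF B'(2)])
      show "j (k2 s) = j (k1 s)" using that SA h1 h2 k1(2) k2(2) by (auto simp: subset_iff)
    qed (use that SA c in auto)
    then have "k1 = k2"
      using univ[OF B'(1), of k1] k1(1) k2(1) c(1) SA by blast
    then have "h1 x = h2 x" if "x \<in> carrier A" for x
      using k1(2) k2(2) that by metis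
    then show "h1 = h2"
      using h1 h2 by (intro extensionalityI[of _ "carrier A"]) auto
  qed
qed

end

theory Submission
  imports Defs
begin

text \<open>
  For all \<open>x\<close> and \<open>y\<close>, the identity \<open>bd\<^sub>n = 1\<close> at \<open>(y\<^sub>1, \<dots>, y\<^sub>n\<^sub>-\<^sub>1, x)\<close> says
  \<open>x \<squnion> (x \<rightharpoonup> bd\<^sub>n\<^sub>-\<^sub>1(y)) = 1\<close>. So if the order dual were Heyting, the least \<open>w\<close> with \<open>x \<squnion> w = 1\<close>
  would lie below every \<open>x \<rightharpoonup> bd\<^sub>n\<^sub>-\<^sub>1(y)\<close>. Test this in the algebra of sequences \<open>\<phi>\<close> in the chain
  \<open>{0..n}\<close> that are eventually equal to \<open>\<pi>(\<phi>(0))\<close>, where the endomorphism \<open>\<pi>\<close> of the chain sends the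
  coatom \<open>n - 1\<close> to \<open>n\<close>. Map a generator \<open>x\<close> to \<open>(n - 1, n, n, \<dots>)\<close>, generators \<open>y\<^sub>i\<close>
  (\<open>1 \<le> i < n - 1\<close>) to the constants \<open>i\<close>, and for each \<open>m > 0\<close> a further generator \<open>z\<^sub>m\<close> to the
  sequence with value \<open>n - 1\<close> at \<open>m\<close> and \<open>0\<close> elsewhere. The image of \<open>w\<close> has value \<open>n\<close> at \<open>0\<close>, hence
  at almost all \<open>m\<close>; but using \<open>z\<^sub>m\<close> for \<open>y\<^sub>n\<^sub>-\<^sub>1\<close> bounds its value at \<open>m\<close> by \<open>n - 1\<close>.
\<close>

section \<open>General facts on Heyting algebras and their homomorphisms\<close>

lemma heyting_algebra_himp_eqI:
  assumes "heyting_algebra L" "x \<in> carrier L" "y \<in> carrier L"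
    and "greatest L z {w \<in> carrier L. w \<sqinter>\<^bsub>L\<^esub> x \<sqsubseteq>\<^bsub>L\<^esub> y}"
  shows "x \<rightharpoonup>\<^bsub>L\<^esub> y = z"
proof -
  interpret heyting_algebra L by fact
  show ?thesis using greatest_unique[OF himp_greatest[OF assms(2,3)] assms(4)] by simp
qed

lemma heyting_hom_mono:
  assumes "heyting_algebra A" "heyting_algebra B" "h \<in> heyting_hom A B"
    and "x \<in> carrier A" "y \<in> carrier A" "x \<sqsubseteq>\<^bsub>A\<^esub> y"
  shows "h x \<sqsubseteq>\<^bsub>B\<^esub> h y"
proof -
  interpret A: heyting_algebra A by fact
  interpret B: heyting_algebra B by fact
  have "x \<sqinter>\<^bsub>A\<^esub> y = x"
    using assms(4-6) by (intro A.le_antisym A.meet_left A.meet_le) auto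
  then have "h x \<sqinter>\<^bsub>B\<^esub> h y = h x" and "h x \<in> carrier B" "h y \<in> carrier B"
    using assms(3-5) by (force simp: heyting_hom_def)+
  then show ?thesis using B.meet_right by metis
qed

lemma heyting_hom_bd:
  assumes "heyting_algebra A" "h \<in> heyting_hom A B" "x \<in> {1..k} \<rightarrow> carrier A"
  shows "h (bd A x k) = bd B (h \<circ> x) k"
proof -
  interpret A: heyting_algebra A by fact
  show ?thesis using assms(3)
  proof (induction k)
    case 0
    then show ?case using assms(2) by (simp add: heyting_hom_def)
  next
    case (Suc k)
    then have "x \<in> {1..k} \<rightarrow> carrier A" "x (Suc k) \<in> carrier A" by (auto simp: Pi_iff)
    with Suc.IH A.bd_closed[of x k] assms(2) show ?case by (simp add: heyting_hom_def)
  qed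
qed

text \<open>The top of \<open>L\<close> is the bottom of the order dual and joins of
  \<open>L\<close> are meets there, so \<open>w\<close> is the pseudocomplement of \<open>x\<close>
  in the dual.\<close>

lemma bi_heyting_least_join_top:
  assumes "bi_heyting_algebra L" "x \<in> carrier L"
  obtains w where "w \<in> carrier L" "x \<squnion>\<^bsub>L\<^esub> w = \<top>\<^bsub>L\<^esub>"
    "\<And>v. \<lbrakk>v \<in> carrier L; x \<squnion>\<^bsub>L\<^esub> v = \<top>\<^bsub>L\<^esub>\<rbrakk> \<Longrightarrow> w \<sqsubseteq>\<^bsub>L\<^esub> v"
proof -
  interpret L: heyting_algebra L using assms by (simp add: bi_heyting_algebra_def)
  interpret D: heyting_algebra "inv_gorder L" using assms by (simp add: bi_heyting_algebra_def)
  have meet: "meet (inv_gorder L) v x = v \<squnion>\<^bsub>L\<^esub> x" for v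
    by (simp add: meet_def join_def inf_def sup_def)
  obtain w where w: "greatest (inv_gorder L) w
      {v \<in> carrier (inv_gorder L). meet (inv_gorder L) v x \<sqsubseteq>\<^bsub>inv_gorder L\<^esub> \<top>\<^bsub>L\<^esub>}"
    using D.himp_exists[of x "\<top>\<^bsub>L\<^esub>"] assms(2) by auto
  have *: "\<top>\<^bsub>L\<^esub> \<sqsubseteq>\<^bsub>L\<^esub> v \<squnion>\<^bsub>L\<^esub> x \<longleftrightarrow> x \<squnion>\<^bsub>L\<^esub> v = \<top>\<^bsub>L\<^esub>" if "v \<in> carrier L" for v
  proof -
    have "v \<squnion>\<^bsub>L\<^esub> x = x \<squnion>\<^bsub>L\<^esub> v" by (simp add: join_def insert_commute)
    then show ?thesis
      using that assms(2) L.le_antisym[of "x \<squnion>\<^bsub>L\<^esub> v" "\<top>\<^bsub>L\<^esub>"] L.top_higher[of "x \<squnion>\<^bsub>L\<^esub> v"] by auto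
  qed
  show ?thesis using that[of w] w * by (auto simp: least_def meet)
qed

section \<open>The Heyting algebra of sequences in a finite chain\<close>

definition chain_imp :: "nat \<Rightarrow> nat \<Rightarrow> nat \<Rightarrow> nat"
  where "chain_imp n a b = (if a \<le> b then n else b)"

text \<open>Collapsing the two largest elements preserves the lattice operations and the implication
  of the chain \<open>{0..n}\<close>; for \<open>n >= 2\<close> it also fixes 0.\<close>

definition merge_coatom :: "nat \<Rightarrow> nat \<Rightarrow> nat"
  where "merge_coatom n a = (if a = n - 1 then n else a)"

definition seq_algebra :: "nat \<Rightarrow> (nat \<Rightarrow> nat) gorder"
  where "seq_algebra n =
    \<lparr>carrier = {\<phi>. (\<forall>m. \<phi> m \<le> n) \<and> (\<forall>\<^sub>F m in sequentially. \<phi> m = merge_coatom n (\<phi> 0))},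
     eq = (=), le = (\<le>)\<rparr>"

lemma carrier_seq_algebra: "carrier (seq_algebra n) =
    {\<phi>. (\<forall>m. \<phi> m \<le> n) \<and> (\<forall>\<^sub>F m in sequentially. \<phi> m = merge_coatom n (\<phi> 0))}"
  and le_seq_algebra: "\<phi> \<sqsubseteq>\<^bsub>seq_algebra n\<^esub> \<psi> \<longleftrightarrow> (\<forall>m. \<phi> m \<le> \<psi> m)"
  by (simp_all add: seq_algebra_def le_fun_def)

text \<open>Almost all values of both sequences are images under \<open>merge_coatom n\<close> of
  their values at 0. Since \<open>F\<close> commutes with that map, the combined sequence has the
  same property.\<close>

lemma seq_algebra_closed2:
  assumes "\<phi> \<in> carrier (seq_algebra n)" "\<psi> \<in> carrier (seq_algebra n)"
    and "\<And>a b. \<lbrakk>a \<le> n; b \<le> n\<rbrakk> \<Longrightarrow> F a b \<le> n"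
    and "\<And>a b. \<lbrakk>a \<le> n; b \<le> n\<rbrakk> \<Longrightarrow>
      F (merge_coatom n a) (merge_coatom n b) = merge_coatom n (F a b)"
  shows "(\<lambda>m. F (\<phi> m) (\<psi> m)) \<in> carrier (seq_algebra n)"
proof -
  have "\<forall>\<^sub>F m in sequentially. \<phi> m = merge_coatom n (\<phi> 0) \<and> \<psi> m = merge_coatom n (\<psi> 0)"
    using assms(1,2) by (simp add: carrier_seq_algebra eventually_conj_iff)
  then have "\<forall>\<^sub>F m in sequentially. F (\<phi> m) (\<psi> m) = merge_coatom n (F (\<phi> 0) (\<psi> 0))"
    by (rule eventually_mono) (use assms in \<open>simp add: carrier_seq_algebra\<close>)
  then show ?thesis using assms by (simp add: carrier_seq_algebra)
qed

lemma
  assumes "\<phi> \<in> carrier (seq_algebra n)" "\<psi> \<in> carrier (seq_algebra n)"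
  shows seq_algebra_max_closed: "(\<lambda>m. max (\<phi> m) (\<psi> m)) \<in> carrier (seq_algebra n)"
    and seq_algebra_min_closed: "(\<lambda>m. min (\<phi> m) (\<psi> m)) \<in> carrier (seq_algebra n)"
    and seq_algebra_imp_closed: "(\<lambda>m. chain_imp n (\<phi> m) (\<psi> m)) \<in> carrier (seq_algebra n)"
  by (rule seq_algebra_closed2[OF assms]; auto simp: merge_coatom_def chain_imp_def)+

context
  fixes n :: nat
  assumes n: "n \<ge> 2"
begin

interpretation B: partial_order "seq_algebra n"
  by unfold_locales (auto simp: seq_algebra_def)

text \<open>A constant sequence must take a fixed point of \<open>merge_coatom n\<close> as its
  value; this excludes only the coatom.\<close>

lemma seq_algebra_const_closed: "i \<le> n \<Longrightarrow> i \<noteq> n - 1 \<Longrightarrow> (\<lambda>_. i) \<in> carrier (seq_algebra n)"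
  by (simp add: carrier_seq_algebra merge_coatom_def)

lemma seq_algebra_join_least:
  assumes "\<phi> \<in> carrier (seq_algebra n)" "\<psi> \<in> carrier (seq_algebra n)"
  shows "least (seq_algebra n) (\<lambda>m. max (\<phi> m) (\<psi> m)) (Upper (seq_algebra n) {\<phi>, \<psi>})"
  using assms seq_algebra_max_closed[OF assms]
  by (auto simp: least_def Upper_def le_seq_algebra)

lemma seq_algebra_meet_greatest:
  assumes "\<phi> \<in> carrier (seq_algebra n)" "\<psi> \<in> carrier (seq_algebra n)"
  shows "greatest (seq_algebra n) (\<lambda>m. min (\<phi> m) (\<psi> m)) (Lower (seq_algebra n) {\<phi>, \<psi>})"
  using assms seq_algebra_min_closed[OF assms]
  by (auto simp: greatest_def Lower_def le_seq_algebra)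

lemma seq_algebra_bot_least: "least (seq_algebra n) (\<lambda>_. 0) (carrier (seq_algebra n))"
  using seq_algebra_const_closed[of 0] n by (auto simp: least_def le_seq_algebra)

lemma seq_algebra_top_greatest: "greatest (seq_algebra n) (\<lambda>_. n) (carrier (seq_algebra n))"
  using seq_algebra_const_closed[of n] n
  by (auto simp: greatest_def le_seq_algebra) (auto simp: carrier_seq_algebra)

interpretation B: bounded_lattice "seq_algebra n"
  using seq_algebra_join_least seq_algebra_meet_greatest seq_algebra_bot_least
    seq_algebra_top_greatest
  by unfold_locales blast+

lemma bot_seq_algebra: "\<bottom>\<^bsub>seq_algebra n\<^esub> = (\<lambda>_. 0)"
  by (rule B.least_unique[OF B.bottom_least seq_algebra_bot_least])

lemma top_seq_algebra: "\<top>\<^bsub>seq_algebra n\<^esub> = (\<lambda>_. n)"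
  by (rule B.greatest_unique[OF B.top_greatest seq_algebra_top_greatest])

lemma join_seq_algebra:
  assumes "\<phi> \<in> carrier (seq_algebra n)" "\<psi> \<in> carrier (seq_algebra n)"
  shows "\<phi> \<squnion>\<^bsub>seq_algebra n\<^esub> \<psi> = (\<lambda>m. max (\<phi> m) (\<psi> m))"
  unfolding join_def
  by (rule B.least_unique[OF B.sup_of_two_least[OF assms] seq_algebra_join_least[OF assms]])

lemma meet_seq_algebra:
  assumes "\<phi> \<in> carrier (seq_algebra n)" "\<psi> \<in> carrier (seq_algebra n)"
  shows "\<phi> \<sqinter>\<^bsub>seq_algebra n\<^esub> \<psi> = (\<lambda>m. min (\<phi> m) (\<psi> m))"
  unfolding meet_def
  by (rule B.greatest_unique[OF B.inf_of_two_greatest[OF assms] seq_algebra_meet_greatest[OF assms]])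

lemma seq_algebra_himp_greatest:
  assumes "\<phi> \<in> carrier (seq_algebra n)" "\<psi> \<in> carrier (seq_algebra n)"
  shows "greatest (seq_algebra n) (\<lambda>m. chain_imp n (\<phi> m) (\<psi> m))
    {\<chi> \<in> carrier (seq_algebra n). \<chi> \<sqinter>\<^bsub>seq_algebra n\<^esub> \<phi> \<sqsubseteq>\<^bsub>seq_algebra n\<^esub> \<psi>}"
proof -
  \<comment> \<open>Residuation in the chain. If \<open>a <= b\<close>, the right side holds for
    every \<open>c\<close>, so the left side needs \<open>c <= n\<close>.\<close>
  have *: "c \<le> chain_imp n a b \<longleftrightarrow> min c a \<le> b" if "c \<le> n" for a b c
    using that by (auto simp: chain_imp_def min_def)
  have "{\<chi> \<in> carrier (seq_algebra n). \<chi> \<sqinter>\<^bsub>seq_algebra n\<^esub> \<phi> \<sqsubseteq>\<^bsub>seq_algebra n\<^esub> \<psi>} =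
      {\<chi> \<in> carrier (seq_algebra n). \<chi> \<sqsubseteq>\<^bsub>seq_algebra n\<^esub> (\<lambda>m. chain_imp n (\<phi> m) (\<psi> m))}"
    using assms(1) * by (auto simp: le_seq_algebra meet_seq_algebra carrier_seq_algebra)
  then show ?thesis
    using seq_algebra_imp_closed[OF assms] by (simp add: greatest_def le_seq_algebra subset_iff)
qed

interpretation B: heyting_algebra "seq_algebra n"
  using seq_algebra_himp_greatest by unfold_locales blast

lemma himp_seq_algebra:
  assumes "\<phi> \<in> carrier (seq_algebra n)" "\<psi> \<in> carrier (seq_algebra n)"
  shows "\<phi> \<rightharpoonup>\<^bsub>seq_algebra n\<^esub> \<psi> = (\<lambda>m. chain_imp n (\<phi> m) (\<psi> m))"
  by (rule heyting_algebra_himp_eqI[OF B.heyting_algebra_axioms assms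
        seq_algebra_himp_greatest[OF assms]])

section \<open>Values of the terms \<open>bd\<close> in the sequence algebra\<close>

lemma bd_seq_algebra_Suc:
  assumes "x \<in> {1..Suc k} \<rightarrow> carrier (seq_algebra n)"
  shows "bd (seq_algebra n) x (Suc k) m =
    max (x (Suc k) m) (chain_imp n (x (Suc k) m) (bd (seq_algebra n) x k m))"
proof -
  have "x (Suc k) \<in> carrier (seq_algebra n)" "bd (seq_algebra n) x k \<in> carrier (seq_algebra n)"
    using assms by (auto simp: Pi_iff intro: B.bd_closed)
  then show ?thesis by (simp add: join_seq_algebra himp_seq_algebra seq_algebra_imp_closed)
qed

text \<open>Below \<open>n\<close> every step raises the value: if \<open>x (Suc k) m\<close>
  exceeds the previous value, so does the join; otherwise the implication is already
  \<open>n\<close>.\<close>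

lemma bd_seq_algebra_lower_bound:
  assumes "x \<in> {1..k} \<rightarrow> carrier (seq_algebra n)"
  shows "min k n \<le> bd (seq_algebra n) x k m"
  using assms
proof (induction k)
  case (Suc k)
  then have "min k n \<le> bd (seq_algebra n) x k m" by (auto simp: Pi_iff)
  with Suc.prems show ?case by (auto simp: bd_seq_algebra_Suc chain_imp_def simp del: bd.simps)
qed simp

lemma GA_algebra_seq_algebra: "GA_algebra (seq_algebra n) n"
proof unfold_locales
  fix \<phi> \<psi> assume *: "\<phi> \<in> carrier (seq_algebra n)" "\<psi> \<in> carrier (seq_algebra n)"
  have "max (chain_imp n (\<phi> m) (\<psi> m)) (chain_imp n (\<psi> m) (\<phi> m)) = n" for m
    using * by (auto simp: carrier_seq_algebra chain_imp_def max_def intro: antisym)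
  with * show "(\<phi> \<rightharpoonup>\<^bsub>seq_algebra n\<^esub> \<psi>) \<squnion>\<^bsub>seq_algebra n\<^esub> (\<psi> \<rightharpoonup>\<^bsub>seq_algebra n\<^esub> \<phi>) = \<top>\<^bsub>seq_algebra n\<^esub>"
    by (simp add: himp_seq_algebra join_seq_algebra seq_algebra_imp_closed top_seq_algebra)
next
  fix x assume x: "x \<in> {1..n} \<rightarrow> carrier (seq_algebra n)"
  have "bd (seq_algebra n) x n m = n" for m
    using bd_seq_algebra_lower_bound[OF x, of m] B.bd_closed[OF x]
    by (simp add: carrier_seq_algebra antisym)
  then show "bd (seq_algebra n) x n = \<top>\<^bsub>seq_algebra n\<^esub>" by (auto simp: top_seq_algebra)
qed

text \<open>The implication from \<open>Suc k\<close> to the previous value \<open>k\<close> is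
  again \<open>k\<close>, so each join adds exactly one.\<close>

lemma bd_seq_algebra_increasing:
  assumes "x \<in> {1..k} \<rightarrow> carrier (seq_algebra n)" "\<And>i. i \<in> {1..k} \<Longrightarrow> x i m = i"
  shows "bd (seq_algebra n) x k m = k"
  using assms
proof (induction k)
  case (Suc k)
  then have "bd (seq_algebra n) x k m = k" by (auto simp: Pi_iff)
  with Suc.prems show ?case by (simp add: bd_seq_algebra_Suc chain_imp_def del: bd.simps)
qed (simp add: bot_seq_algebra)

text \<open>The value at 0 determines the tail, hence \<open>m > 0\<close>. The tail 0 is admissible
  because 0 is not the coatom when \<open>n >= 2\<close>.\<close>

lemma seq_algebra_spike_closed:
  assumes "m > 0" "a \<le> n"
  shows "(\<lambda>l. if l = m then a else 0) \<in> carrier (seq_algebra n)"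
proof -
  have "\<forall>\<^sub>F l in sequentially. (if l = m then a else 0) = 0"
    using eventually_gt_at_top[of m] by (rule eventually_mono) auto
  then show ?thesis using assms n by (simp add: carrier_seq_algebra merge_coatom_def)
qed

text \<open>Merging the coatom with the top is what admits this sequence, which is below the top
  only at 0.\<close>

lemma seq_algebra_drop_closed: "(\<lambda>l. if l = 0 then n - 1 else n) \<in> carrier (seq_algebra n)"
proof -
  have "\<forall>\<^sub>F l in sequentially. (if l = 0 then n - 1 else n) = n"
    using eventually_gt_at_top[of "0::nat"] by (rule eventually_mono) auto
  then show ?thesis by (simp add: carrier_seq_algebra merge_coatom_def)
qed

end

section \<open>The contradiction in the free algebra\<close>

theorem theorem5p12:
  fixes n :: nat and A :: "'a gorder" and S :: "'a set"
  assumes "n \<ge> 2"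
    and "infinite S"
    and "free_GA_algebra n A S"
  shows "\<not> bi_heyting_algebra A"
proof
  assume bi: "bi_heyting_algebra A"
  let ?B = "seq_algebra n"
  note n = \<open>n \<ge> 2\<close>
  have SA: "S \<subseteq> carrier A" and "GA_algebra A n"
    using assms(3) by (auto simp: free_GA_algebra_def)
  interpret A: GA_algebra A n by fact
  interpret B: GA_algebra ?B n by (rule GA_algebra_seq_algebra[OF n])
  obtain e :: "nat \<Rightarrow> 'a" where e: "inj e" "range e \<subseteq> S"
    using infinite_countable_subset[OF assms(2)] by blast
  then have eA: "e k \<in> carrier A" for k using SA by blast
  \<comment> \<open>Index 0 serves \<open>x\<close>, the indices from 1 to \<open>n - 2\<close> the
    constants, and each \<open>k >= n - 1\<close> the spike at \<open>k - n + 2\<close>, a position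
    that is at least 1.\<close>
  define F :: "nat \<Rightarrow> nat \<Rightarrow> nat" where
    "F k = (if k = 0 then (\<lambda>l. if l = 0 then n - 1 else n)
      else if k < n - 1 then (\<lambda>_. k)
      else (\<lambda>l. if l = Suc k - (n - 1) then n - 1 else 0))" for k
  have FB: "F k \<in> carrier ?B" for k
    using n seq_algebra_drop_closed[OF n] seq_algebra_const_closed[OF n, of k]
      seq_algebra_spike_closed[OF n, of "Suc k - (n - 1)" "n - 1"]
    by (simp add: F_def)
  \<comment> \<open>Generators outside \<open>range e\<close> also get a value in the carrier, as
    every \<open>F k\<close> lies there.\<close>
  then have "F \<circ> inv e \<in> S \<rightarrow> carrier ?B" by simp
  then obtain h where h: "h \<in> heyting_hom A ?B" "\<And>s. s \<in> S \<Longrightarrow> h s = F (inv e s)"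
    using free_GA_algebra_universal[OF assms(3,2) B.GA_algebra_axioms, of "F \<circ> inv e"] by auto
  have he: "h (e k) = F k" for k using h(2)[of "e k"] e by auto
  have hB: "a \<in> carrier A \<Longrightarrow> h a \<in> carrier ?B" for a
    using h(1) by (auto simp: heyting_hom_def)
  obtain w where w: "w \<in> carrier A" "e 0 \<squnion>\<^bsub>A\<^esub> w = \<top>\<^bsub>A\<^esub>"
    and least: "\<And>v. \<lbrakk>v \<in> carrier A; e 0 \<squnion>\<^bsub>A\<^esub> v = \<top>\<^bsub>A\<^esub>\<rbrakk> \<Longrightarrow> w \<sqsubseteq>\<^bsub>A\<^esub> v"
    using bi_heyting_least_join_top[OF bi eA[of 0]] by blast
  have "h (e 0) \<squnion>\<^bsub>?B\<^esub> h w = \<top>\<^bsub>?B\<^esub>"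
  proof -
    have "h (e 0 \<squnion>\<^bsub>A\<^esub> w) = h (e 0) \<squnion>\<^bsub>?B\<^esub> h w" "h \<top>\<^bsub>A\<^esub> = \<top>\<^bsub>?B\<^esub>"
      using h(1) w(1) eA by (simp_all add: heyting_hom_def)
    then show ?thesis using w(2) by simp
  qed
  then have "max (h (e 0) 0) (h w 0) = n"
    using join_seq_algebra[OF n hB[OF eA] hB[OF w(1)]] top_seq_algebra[OF n] by metis
  \<comment> \<open>In a chain a join equals \<open>n\<close> only if one of its arguments does, and
    \<open>e 0\<close> has value \<open>n - 1\<close> at 0.\<close>
  then have "h w 0 = n" using n by (auto simp: he F_def max_def split: if_splits)
  then have "merge_coatom n (h w 0) = n" by (simp add: merge_coatom_def)
  then have "\<forall>\<^sub>F m in sequentially. h w m = n"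
    using hB[OF w(1)] by (simp add: carrier_seq_algebra)
  \<comment> \<open>Positivity of \<open>m\<close> provides the spike at \<open>m\<close> and gives
    \<open>F 0 m = n\<close>.\<close>
  then have "\<forall>\<^sub>F m in sequentially. h w m = n \<and> m > 0"
    using eventually_gt_at_top by (rule eventually_conj)
  then obtain m where m: "h w m = n" "m > 0"
    using eventually_happens by force
  \<comment> \<open>The entry at \<open>n\<close> is outermost in \<open>bd\<close>. The index
    \<open>m + n - 2\<close> is that of the spike at \<open>m\<close>, whose value
    \<open>n - 1\<close> there continues the constants 1 to \<open>n - 2\<close>.\<close>
  define y where "y i = (if i = n then e 0 else if i = n - 1 then e (m + n - 2) else e i)" for i
  have yA: "y i \<in> carrier A" for i using eA by (simp add: y_def)
  have bdA: "bd A y (n - 1) \<in> carrier A" by (rule A.bd_closed) (simp add: yA)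
  have "y (Suc (n - 1)) = e 0" using n by (simp add: y_def)
  have "bd A y (Suc (n - 1)) = \<top>\<^bsub>A\<^esub>" using A.bd_eq_top[of y] yA n by simp
  then have "e 0 \<squnion>\<^bsub>A\<^esub> (e 0 \<rightharpoonup>\<^bsub>A\<^esub> bd A y (n - 1)) = \<top>\<^bsub>A\<^esub>"
    using \<open>y (Suc (n - 1)) = e 0\<close> by (simp only: bd.simps)
  then have "w \<sqsubseteq>\<^bsub>A\<^esub> e 0 \<rightharpoonup>\<^bsub>A\<^esub> bd A y (n - 1)" using least eA bdA by simp
  then have "h w \<sqsubseteq>\<^bsub>?B\<^esub> h (e 0 \<rightharpoonup>\<^bsub>A\<^esub> bd A y (n - 1))"
    using heyting_hom_mono[OF A.heyting_algebra_axioms B.heyting_algebra_axioms h(1)] w(1) eA bdA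
    by simp
  also have "h (e 0 \<rightharpoonup>\<^bsub>A\<^esub> bd A y (n - 1)) = F 0 \<rightharpoonup>\<^bsub>?B\<^esub> h (bd A y (n - 1))"
    using h(1) eA bdA by (simp add: heyting_hom_def flip: he)
  finally have "h w m \<le> chain_imp n (F 0 m) (h (bd A y (n - 1)) m)"
    unfolding himp_seq_algebra[OF n FB hB[OF bdA]] le_seq_algebra by blast
  moreover have "F 0 m = n" using m by (simp add: F_def)
  moreover have "h (bd A y (n - 1)) m = n - 1"
  proof -
    have "h (bd A y (n - 1)) = bd ?B (h \<circ> y) (n - 1)"
      by (rule heyting_hom_bd[OF A.heyting_algebra_axioms h(1)]) (simp add: yA)
    moreover have "bd ?B (h \<circ> y) (n - 1) m = n - 1"
    proof (rule bd_seq_algebra_increasing[OF n])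
      show "(h \<circ> y) i m = i" if "i \<in> {1..n - 1}" for i
        using that m n by (auto simp: y_def he F_def)
    qed (simp add: yA hB)
    ultimately show ?thesis by simp
  qed
  \<comment> \<open>At \<open>m\<close> the implication from \<open>n\<close> to
    \<open>n - 1\<close> is \<open>n - 1\<close>, yet it bounds \<open>h w m = n\<close> from
    above.\<close>
  ultimately show False using m n by (simp add: chain_imp_def split: if_splits)
qed

end
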